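(* Let $\alpha$ be a $C^3$ regular twisted curve in $\mathbb{E}^3$ parametrized by arc-length $s$, with curvature $\kappa_\alpha$ and torsion $\tau_\alpha$. Fix $s_0$, let $a_0=P_S(s_0)$ and $r_0=R_S(s_0)$ be the center and radius of the osculating sphere of $\alpha$ at $\alpha(s_0)$, and for $t$ near $s_0$ let $\beta(t)=a_0+r_0\,\frac{\alpha(t)-a_0}{\Vert\alpha(t)-a_0\Vert}$ be the (osculating) spherical projection of $\alpha$, with curvature $\kappa_\beta$ and torsion $\tau_\beta$. Then the torsions and the curvatures coincide at $s_0$: $$\kappa_\alpha(s_0)=\kappa_\beta(s_0)\quad\text{and}\quad \tau_\alpha(s_0)=\tau_\beta(s_0).$$ In addition, the curvature function can be written as $$\kappa_\alpha(s_0)=\frac{1}{R_S(s_0)}\sqrt{1+J^2(s_0)},$$ and the torsion as $$\tau_\alpha(s_0)=\frac{\langle\alpha(s_0)-P_S(s_0),\alpha'(s_0)\times\alpha'''(s_0)\rangle}{1+J^2(s_0)}=\frac{J'(s_0)}{1+J^2(s_0)}+\frac{\kappa_\alpha(s_0)\,\varsigma(s_0)}{1+J^2(s_0)},$$ where $J(s)=\langle\alpha(s)-P_S(s),\alpha'(s)\times\alpha''(s)\rangle$ and $\varsigma=\tau_\alpha\rho+\frac{\mathrm d}{\mathrm ds}\left(\frac{\rho'}{\tau_\alpha}\right)$ with $\rho=1/\kappa_\alpha$.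
   Context: $\mathbb{E}^3$ is $\mathbb{R}^3$ with the standard inner product $\langle\cdot,\cdot\rangle$ and norm $\Vert\cdot\Vert$. The Frenet frame $\{\mathbf t,\mathbf n,\mathbf b\}$ of an arc-length parametrized curve satisfies $\mathbf t=\alpha'$, $\mathbf t'=\kappa\mathbf n$ with $\kappa=\Vert\alpha''\Vert$, $\mathbf b=\mathbf t\times\mathbf n$, $\mathbf n'=-\kappa\mathbf t+\tau\mathbf b$, $\mathbf b'=-\tau\mathbf n$. A curve is twisted if its curvature and torsion are nonzero at every point. For a curve $\beta$ with a general regular parameter, $\kappa=\Vert\dot\beta\times\ddot\beta\Vert/\Vert\dot\beta\Vert^3$ and $\tau=\langle\dot\beta\times\ddot\beta,\dddot\beta\rangle/\Vert\dot\beta\times\ddot\beta\Vert^2$. The osculating sphere of $\alpha$ at $\alpha(s)$ is the sphere having contact of order 3 with $\alpha$ there; its center and radius are $P_S=\alpha+\rho\,\mathbf n+\frac{\rho'}{\tau}\mathbf b$ and $R_S=\sqrt{\rho^2+(\rho'/\tau)^2}$, where $\rho=1/\kappa$.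
   Formalization: The last expression for the torsion, with J'(s_0) and ς(s_0), is stated when ρ'/τ_α is differentiable at s_0; for a curve that is only C^3 these derivatives may fail to exist (e.g. κ=e^{-s}, τ=1+|s| at s_0=0). *)

theory Defs
  imports "HOL-Analysis.Analysis"
begin

definition vderiv :: "(real \<Rightarrow> real^3) \<Rightarrow> real \<Rightarrow> real^3" where
  "vderiv \<gamma> s = vector_derivative \<gamma> (at s)"

text \<open>Meant for open \<open>I\<close>: the derivatives of order below \<open>k\<close> are differentiable at
  each point of \<open>I\<close>, and the derivative of order \<open>k\<close> is continuous on \<open>I\<close>.\<close>

definition C_k_on :: "nat \<Rightarrow> (real \<Rightarrow> real^3) \<Rightarrow> real set \<Rightarrow> bool" where
  "C_k_on k \<gamma> I \<longleftrightarrow>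
     (\<forall>j<k. \<forall>s\<in>I. (vderiv ^^ j) \<gamma> differentiable (at s)) \<and> continuous_on I ((vderiv ^^ k) \<gamma>)"

definition arc_length_on :: "(real \<Rightarrow> real^3) \<Rightarrow> real set \<Rightarrow> bool" where
  "arc_length_on \<gamma> I \<longleftrightarrow> (\<forall>s\<in>I. norm (vderiv \<gamma> s) = 1)"

subsection \<open>Frenet apparatus of a curve parametrized by arc length\<close>

definition tangent :: "(real \<Rightarrow> real^3) \<Rightarrow> real \<Rightarrow> real^3" where
  "tangent \<alpha> s = vderiv \<alpha> s"

definition curvature :: "(real \<Rightarrow> real^3) \<Rightarrow> real \<Rightarrow> real" where
  "curvature \<alpha> s = norm (vderiv (vderiv \<alpha>) s)"

definition normal :: "(real \<Rightarrow> real^3) \<Rightarrow> real \<Rightarrow> real^3" where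
  "normal \<alpha> s = vderiv (tangent \<alpha>) s /\<^sub>R curvature \<alpha> s"

definition binormal :: "(real \<Rightarrow> real^3) \<Rightarrow> real \<Rightarrow> real^3" where
  "binormal \<alpha> s = cross3 (tangent \<alpha> s) (normal \<alpha> s)"

text \<open>The torsion is the coefficient of the binormal in the Frenet equation
  \<open>n' = - \<kappa> t + \<tau> b\<close>.\<close>

definition torsion :: "(real \<Rightarrow> real^3) \<Rightarrow> real \<Rightarrow> real" where
  "torsion \<alpha> s = vderiv (normal \<alpha>) s \<bullet> binormal \<alpha> s"

definition twisted_on :: "(real \<Rightarrow> real^3) \<Rightarrow> real set \<Rightarrow> bool" where
  "twisted_on \<alpha> I \<longleftrightarrow> (\<forall>s\<in>I. curvature \<alpha> s \<noteq> 0 \<and> torsion \<alpha> s \<noteq> 0)"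

subsection \<open>Curvature and torsion in a general regular parameter\<close>

definition reg_curvature :: "(real \<Rightarrow> real^3) \<Rightarrow> real \<Rightarrow> real" where
  "reg_curvature \<beta> t =
     norm (cross3 (vderiv \<beta> t) (vderiv (vderiv \<beta>) t)) / norm (vderiv \<beta> t) ^ 3"

definition reg_torsion :: "(real \<Rightarrow> real^3) \<Rightarrow> real \<Rightarrow> real" where
  "reg_torsion \<beta> t =
     cross3 (vderiv \<beta> t) (vderiv (vderiv \<beta>) t) \<bullet> vderiv (vderiv (vderiv \<beta>)) t
     / (norm (cross3 (vderiv \<beta> t) (vderiv (vderiv \<beta>) t)))\<^sup>2"

subsection \<open>Osculating sphere and osculating spherical projection\<close>

definition rho :: "(real \<Rightarrow> real^3) \<Rightarrow> real \<Rightarrow> real" where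
  "rho \<alpha> s = 1 / curvature \<alpha> s"

definition rho'_over_tau :: "(real \<Rightarrow> real^3) \<Rightarrow> real \<Rightarrow> real" where
  "rho'_over_tau \<alpha> s = deriv (rho \<alpha>) s / torsion \<alpha> s"

definition osc_center :: "(real \<Rightarrow> real^3) \<Rightarrow> real \<Rightarrow> real^3" where
  "osc_center \<alpha> s =
     \<alpha> s + rho \<alpha> s *\<^sub>R normal \<alpha> s + rho'_over_tau \<alpha> s *\<^sub>R binormal \<alpha> s"

definition osc_radius :: "(real \<Rightarrow> real^3) \<Rightarrow> real \<Rightarrow> real" where
  "osc_radius \<alpha> s = sqrt ((rho \<alpha> s)\<^sup>2 + (rho'_over_tau \<alpha> s)\<^sup>2)"

text \<open>Relevant only for \<open>t\<close> near \<open>s0\<close>. There \<open>\<alpha> t\<close> differs from the centre; elsewhere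
  \<open>\<alpha> t\<close> may hit the centre, and then the value is the centre itself.\<close>

definition osc_projection :: "(real \<Rightarrow> real^3) \<Rightarrow> real \<Rightarrow> real \<Rightarrow> real^3" where
  "osc_projection \<alpha> s0 t =
     osc_center \<alpha> s0 +
     osc_radius \<alpha> s0 *\<^sub>R ((\<alpha> t - osc_center \<alpha> s0) /\<^sub>R norm (\<alpha> t - osc_center \<alpha> s0))"

definition J :: "(real \<Rightarrow> real^3) \<Rightarrow> real \<Rightarrow> real" where
  "J \<alpha> s = (\<alpha> s - osc_center \<alpha> s) \<bullet> cross3 (vderiv \<alpha> s) (vderiv (vderiv \<alpha>) s)"

definition varsigma :: "(real \<Rightarrow> real^3) \<Rightarrow> real \<Rightarrow> real" where
  "varsigma \<alpha> s = torsion \<alpha> s * rho \<alpha> s + deriv (rho'_over_tau \<alpha>) s"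

end

theory Submission
  imports Defs
begin

text \<open>Let \<open>m = \<alpha> s0 - osc_center \<alpha> s0\<close>. The osculating sphere is characterized by
  \<open>norm m = osc_radius \<alpha> s0\<close> and by the vanishing at \<open>s0\<close> of the first three
  derivatives of the squared distance from \<open>\<alpha> t\<close> to its centre. Since \<open>\<alpha>\<close> has unit
  speed, the latter means \<open>m \<bullet> \<alpha>' = 0\<close>, \<open>m \<bullet> \<alpha>'' = - 1\<close> and \<open>m \<bullet> \<alpha>''' = 0\<close>
  (\<open>inner_radial_\<alpha>1\<close>, \<open>inner_radial_\<alpha>2\<close>, \<open>inner_radial_\<alpha>3\<close>). The spherical projection
  multiplies the vector from the centre to \<open>\<alpha> t\<close> by a smooth function of that squared distance.
  This factor is \<open>1\<close> at \<open>s0\<close> and its first three derivatives vanish there, so the projection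
  and \<open>\<alpha>\<close> have the same derivatives of orders one to three at \<open>s0\<close>
  (\<open>vderivs_of_radial_projection\<close>). Curvature and torsion depend on these derivatives only,
  hence they agree.

  The explicit formulas come from \<open>J = - \<kappa> \<sigma>\<close>, where \<open>\<sigma> = \<rho>' / \<tau>\<close> is the binormal
  coordinate of the centre relative to the curve: the normal coordinate is
  \<open>\<rho> = 1 / \<kappa>\<close>, so \<open>\<kappa>\<^sup>2 R\<^sup>2 = 1 + J\<^sup>2\<close>, and differentiating \<open>J = - \<kappa> \<sigma>\<close>
  with \<open>\<kappa>' = - \<kappa>\<^sup>2 \<tau> \<sigma>\<close> relates \<open>J'\<close> to \<open>\<tau> (1 + J\<^sup>2)\<close> (\<open>J_deriv\<close>).\<close>

section \<open>Successive derivatives along a curve\<close>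

lemma has_vector_derivative_vderiv:
  "\<gamma> differentiable (at s) \<Longrightarrow> (\<gamma> has_vector_derivative vderiv \<gamma> s) (at s)"
  unfolding vderiv_def by (simp add: vector_derivative_works)

lemma vderiv_eqI: "(\<gamma> has_vector_derivative v) (at s) \<Longrightarrow> vderiv \<gamma> s = v"
  unfolding vderiv_def by (rule vector_derivative_at)

text \<open>Differentiability is local, so a formula for a derivative that holds near a point can be
  differentiated again there.\<close>

lemma vderiv_eq_on_open:
  assumes "open U" "s \<in> U" "\<And>t. t \<in> U \<Longrightarrow> \<gamma> t = \<delta> t"
    and "(\<delta> has_vector_derivative v) (at s)"
  shows "vderiv \<gamma> s = v"
  by (rule vderiv_eqI, rule has_vector_derivative_transform_within_open[OF assms(4,1,2)])
    (simp add: assms(3))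

lemma has_derivative_inner_curves:
  fixes f g :: "real \<Rightarrow> 'a::real_inner"
  assumes "(f has_vector_derivative f') (at s)" "(g has_vector_derivative g') (at s)"
  shows "((\<lambda>t. f t \<bullet> g t) has_real_derivative f s \<bullet> g' + f' \<bullet> g s) (at s)"
proof -
  have "((\<lambda>t. f t \<bullet> g t) has_derivative (\<lambda>x. f s \<bullet> (x *\<^sub>R g') + (x *\<^sub>R f') \<bullet> g s)) (at s)"
    using assms unfolding has_vector_derivative_def by (rule has_derivative_inner)
  then show ?thesis
    unfolding has_field_derivative_def
    by (rule has_derivative_eq_rhs) (simp add: fun_eq_iff algebra_simps)
qed

text \<open>A factor with value one and vanishing derivatives of orders one to three leaves the
  derivatives of \<open>f\<close> up to order three unchanged, since every other term of the Leibniz rule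
  contains a derivative of the factor.\<close>

lemma vderivs_of_jet_constant_multiple:
  fixes f :: "real \<Rightarrow> real^3" and h :: "real \<Rightarrow> real"
  assumes U: "open U" "s0 \<in> U"
    and f: "\<And>t. t \<in> U \<Longrightarrow> (f has_vector_derivative f1 t) (at t)"
      "\<And>t. t \<in> U \<Longrightarrow> (f1 has_vector_derivative f2 t) (at t)"
      "\<And>t. t \<in> U \<Longrightarrow> (f2 has_vector_derivative f3 t) (at t)"
    and h: "\<And>t. t \<in> U \<Longrightarrow> (h has_real_derivative h1 t) (at t)"
      "\<And>t. t \<in> U \<Longrightarrow> (h1 has_real_derivative h2 t) (at t)"
      "(h2 has_real_derivative 0) (at s0)"
    and h0: "h s0 = 1" "h1 s0 = 0" "h2 s0 = 0"
    and \<beta>: "\<And>t. t \<in> U \<Longrightarrow> \<beta> t = c + h t *\<^sub>R f t"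
  shows "vderiv \<beta> s0 = f1 s0"
    and "vderiv (vderiv \<beta>) s0 = f2 s0"
    and "vderiv (vderiv (vderiv \<beta>)) s0 = f3 s0"
proof -
  have d1: "vderiv \<beta> t = h t *\<^sub>R f1 t + h1 t *\<^sub>R f t" if "t \<in> U" for t
    using that
    by (intro vderiv_eq_on_open[OF U(1) _ \<beta>]) (auto intro!: derivative_eq_intros f h)
  have d2: "vderiv (vderiv \<beta>) t = h t *\<^sub>R f2 t + h1 t *\<^sub>R f1 t + (h1 t *\<^sub>R f1 t + h2 t *\<^sub>R f t)"
    if "t \<in> U" for t
    using that
    by (intro vderiv_eq_on_open[OF U(1) _ d1])
      (auto intro!: derivative_eq_intros f h)
  have d3: "vderiv (vderiv (vderiv \<beta>)) s0 = f3 s0"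
    by (rule vderiv_eq_on_open[OF U d2])
      (assumption, (rule f h U derivative_eq_intros refl)+, simp add: h0)
  show "vderiv \<beta> s0 = f1 s0" "vderiv (vderiv \<beta>) s0 = f2 s0"
    using d1[OF U(2)] d2[OF U(2)] by (simp_all add: h0)
  show "vderiv (vderiv (vderiv \<beta>)) s0 = f3 s0" by (rule d3)
qed

text \<open>The three equations at \<open>s0\<close> say that the derivatives of orders one to three of
  \<open>f \<bullet> f\<close> vanish, which is contact of order three with the sphere about the origin. The
  normalizing factor \<open>norm (f s0) / norm (f t)\<close> is a smooth function of \<open>f t \<bullet> f t\<close>, so it
  has the jet of the constant one.\<close>

lemma vderivs_of_radial_projection:
  fixes f :: "real \<Rightarrow> real^3" and c :: "real^3"
  assumes U: "open U" "s0 \<in> U"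
    and f: "\<And>t. t \<in> U \<Longrightarrow> (f has_vector_derivative f1 t) (at t)"
      "\<And>t. t \<in> U \<Longrightarrow> (f1 has_vector_derivative f2 t) (at t)"
      "\<And>t. t \<in> U \<Longrightarrow> (f2 has_vector_derivative f3 t) (at t)"
    and nz: "f s0 \<noteq> 0"
    and contact: "f s0 \<bullet> f1 s0 = 0" "f1 s0 \<bullet> f1 s0 + f s0 \<bullet> f2 s0 = 0"
      "3 * (f1 s0 \<bullet> f2 s0) + f s0 \<bullet> f3 s0 = 0"
  defines "\<beta> \<equiv> \<lambda>t. c + norm (f s0) *\<^sub>R (f t /\<^sub>R norm (f t))"
  shows "vderiv \<beta> s0 = f1 s0"
    and "vderiv (vderiv \<beta>) s0 = f2 s0"
    and "vderiv (vderiv (vderiv \<beta>)) s0 = f3 s0"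
proof -
  define q q1 q2 q3 where "q = (\<lambda>t. f t \<bullet> f t)" and "q1 = (\<lambda>t. 2 * (f t \<bullet> f1 t))"
    and "q2 = (\<lambda>t. 2 * (f1 t \<bullet> f1 t + f t \<bullet> f2 t))"
    and "q3 = (\<lambda>t. 2 * (3 * (f1 t \<bullet> f2 t) + f t \<bullet> f3 t))"
  note ip = has_derivative_inner_curves
  have q: "(q has_real_derivative q1 t) (at t)" "(q1 has_real_derivative q2 t) (at t)"
    "(q2 has_real_derivative q3 t) (at t)" if "t \<in> U" for t
    unfolding q_def q1_def q2_def q3_def
    by (rule DERIV_cong, (rule DERIV_cmult DERIV_add ip f that)+,
        simp add: inner_commute algebra_simps)+
  have q0: "q1 s0 = 0" "q2 s0 = 0" "q3 s0 = 0"
    using contact by (auto simp: q1_def q2_def q3_def)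
  have "continuous_on U f"
    using has_vector_derivative_continuous[OF f(1)] U(1)
    by (auto simp: continuous_on_eq_continuous_at)
  then have "open (U \<inter> f -` (- {0}))"
    using U(1) by (intro continuous_open_preimage) auto
  moreover define V where "V = U \<inter> f -` (- {0})"
  ultimately have V: "open V" "s0 \<in> V" "\<And>t. t \<in> V \<Longrightarrow> t \<in> U \<and> q t > 0"
    using U nz by (auto simp: q_def)
  define r where "r = norm (f s0)"
  \<comment> \<open>As a power of \<open>q\<close>, the factor \<open>r / norm (f t)\<close> has derivatives in which every
    term contains \<open>q1\<close>, \<open>q2\<close> or \<open>q3\<close>.\<close>
  define h h1 h2 where "h = (\<lambda>t. r * q t powr (-1/2))"
    and "h1 = (\<lambda>t. - r / 2 * q t powr (-3/2) * q1 t)"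
    and "h2 = (\<lambda>t. r * (3/4 * q t powr (-5/2) * (q1 t)\<^sup>2 - 1/2 * q t powr (-3/2) * q2 t))"
  have qp: "((\<lambda>t. q t powr a) has_real_derivative a * q t powr (a - 1) * q1 t) (at t)"
    if "t \<in> V" for a t
    using DERIV_powr[OF q(1) _ DERIV_const, of t a] V(3)[OF that]
    by (simp add: powr_diff field_simps)
  have h: "(h has_real_derivative h1 t) (at t)" "(h1 has_real_derivative h2 t) (at t)"
    if "t \<in> V" for t
    unfolding h_def h1_def h2_def using V(3)[OF that]
    by (auto intro!: derivative_eq_intros qp q that simp: field_simps power2_eq_square)
  have h3: "(h2 has_real_derivative 0) (at s0)"
    unfolding h2_def using V
    by (auto intro!: derivative_eq_intros qp q simp: q0)
  have pw: "q t powr (-1/2) = inverse (norm (f t))" if "t \<in> V" for t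
    using V(3)[OF that]
    by (simp add: powr_minus powr_half_sqrt q_def norm_eq_sqrt_inner)
  have h0: "h s0 = 1" "h1 s0 = 0" "h2 s0 = 0"
    using pw V nz by (auto simp: h_def h1_def h2_def q0 r_def)
  have \<beta>: "\<beta> t = c + h t *\<^sub>R f t" if "t \<in> V" for t
    using pw[OF that] by (simp add: \<beta>_def h_def r_def)
  have fV: "\<And>t. t \<in> V \<Longrightarrow> (f has_vector_derivative f1 t) (at t)"
      "\<And>t. t \<in> V \<Longrightarrow> (f1 has_vector_derivative f2 t) (at t)"
      "\<And>t. t \<in> V \<Longrightarrow> (f2 has_vector_derivative f3 t) (at t)"
    using f V by auto
  note jet = vderivs_of_jet_constant_multiple[OF V(1,2) fV h h3 h0 \<beta>]
  show "vderiv \<beta> s0 = f1 s0" "vderiv (vderiv \<beta>) s0 = f2 s0"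
    "vderiv (vderiv (vderiv \<beta>)) s0 = f3 s0"
    by (rule jet; assumption)+
qed

section \<open>Frenet apparatus of a twisted unit-speed curve in terms of its derivatives\<close>

text \<open>The inner and triple products of the first three derivatives of \<open>\<alpha>\<close> determine all
  Frenet quantities below, so every identity about the osculating sphere becomes algebra in these
  products.\<close>

locale twisted_unit_speed_curve =
  fixes \<alpha> :: "real \<Rightarrow> real^3" and I :: "real set"
  assumes open_I: "open I"
    and C3: "C_k_on 3 \<alpha> I"
    and unit_speed: "arc_length_on \<alpha> I"
    and twisted: "twisted_on \<alpha> I"
begin

abbreviation "\<alpha>1 \<equiv> vderiv \<alpha>"
abbreviation "\<alpha>2 \<equiv> vderiv \<alpha>1"
abbreviation "\<alpha>3 \<equiv> vderiv \<alpha>2"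
abbreviation "\<kappa> \<equiv> curvature \<alpha>"
abbreviation "\<tau> \<equiv> torsion \<alpha>"
abbreviation "\<sigma> \<equiv> rho'_over_tau \<alpha>"

lemma derivs:
  assumes "s \<in> I"
  shows "(\<alpha> has_vector_derivative \<alpha>1 s) (at s)"
    and "(\<alpha>1 has_vector_derivative \<alpha>2 s) (at s)"
    and "(\<alpha>2 has_vector_derivative \<alpha>3 s) (at s)"
proof -
  have "(vderiv ^^ j) \<alpha> differentiable at s" if "j < 3" for j
    using C3 assms that by (auto simp: C_k_on_def)
  from this[of 0] this[of 1] this[of 2] show
    "(\<alpha> has_vector_derivative \<alpha>1 s) (at s)"
    "(\<alpha>1 has_vector_derivative \<alpha>2 s) (at s)"
    "(\<alpha>2 has_vector_derivative \<alpha>3 s) (at s)"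
    by (auto simp: eval_nat_numeral intro: has_vector_derivative_vderiv)
qed

lemma derivative_zero_if_constant:
  fixes g :: "real \<Rightarrow> real"
  assumes "(g has_real_derivative d) (at s)" "s \<in> I" "\<And>t. t \<in> I \<Longrightarrow> g t = c"
  shows "d = 0"
proof -
  have "(g has_real_derivative 0) (at s)"
    by (rule has_field_derivative_transform_within_open[OF DERIV_const open_I assms(2)])
      (simp add: assms(3))
  with assms(1) show ?thesis by (rule DERIV_unique)
qed

lemma curvature_pos: "s \<in> I \<Longrightarrow> \<kappa> s > 0"
  using twisted by (auto simp: twisted_on_def curvature_def)

lemma torsion_nonzero: "s \<in> I \<Longrightarrow> \<tau> s \<noteq> 0"
  using twisted by (auto simp: twisted_on_def)

lemma inner_\<alpha>1_\<alpha>1: "s \<in> I \<Longrightarrow> \<alpha>1 s \<bullet> \<alpha>1 s = 1"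
  using unit_speed by (simp add: arc_length_on_def dot_square_norm)

lemma inner_\<alpha>2_\<alpha>2: "\<alpha>2 s \<bullet> \<alpha>2 s = (\<kappa> s)\<^sup>2"
  by (simp add: curvature_def dot_square_norm)

lemma inner_\<alpha>1_\<alpha>2:
  assumes "s \<in> I" shows "\<alpha>1 s \<bullet> \<alpha>2 s = 0"
  using derivative_zero_if_constant[OF has_derivative_inner_curves[OF derivs(2,2)] assms inner_\<alpha>1_\<alpha>1]
    assms by (simp add: inner_commute)

lemma inner_\<alpha>1_\<alpha>3:
  assumes "s \<in> I" shows "\<alpha>1 s \<bullet> \<alpha>3 s = - (\<kappa> s)\<^sup>2"
  using derivative_zero_if_constant[OF has_derivative_inner_curves[OF derivs(2,3)] assms inner_\<alpha>1_\<alpha>2]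
    assms by (simp add: inner_\<alpha>2_\<alpha>2)

lemma curvature_deriv:
  assumes "s \<in> I"
  shows "(\<kappa> has_real_derivative \<alpha>2 s \<bullet> \<alpha>3 s / \<kappa> s) (at s)"
proof -
  have "\<kappa> = (\<lambda>t. sqrt (\<alpha>2 t \<bullet> \<alpha>2 t))"
    by (simp add: curvature_def norm_eq_sqrt_inner fun_eq_iff)
  moreover have "((\<lambda>t. sqrt (\<alpha>2 t \<bullet> \<alpha>2 t)) has_real_derivative
      inverse (sqrt (\<alpha>2 s \<bullet> \<alpha>2 s)) / 2 * (\<alpha>2 s \<bullet> \<alpha>3 s + \<alpha>3 s \<bullet> \<alpha>2 s)) (at s)"
    using curvature_pos[OF assms]
    by (intro DERIV_chain2[OF DERIV_real_sqrt] has_derivative_inner_curves derivs assms)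
      (simp add: inner_\<alpha>2_\<alpha>2)
  ultimately show ?thesis
    using curvature_pos[OF assms]
    by (simp add: inner_\<alpha>2_\<alpha>2 inner_commute[of "\<alpha>3 s"] field_simps)
qed

lemma normal_eq: "normal \<alpha> s = \<alpha>2 s /\<^sub>R \<kappa> s"
proof -
  have "tangent \<alpha> = \<alpha>1" by (simp add: tangent_def fun_eq_iff)
  then show ?thesis by (simp add: normal_def)
qed

lemma binormal_eq: "binormal \<alpha> s = cross3 (\<alpha>1 s) (\<alpha>2 s) /\<^sub>R \<kappa> s"
  by (simp add: binormal_def tangent_def normal_eq cross_mult_right)

lemma norm_cross_\<alpha>1_\<alpha>2:
  assumes "s \<in> I" shows "norm (cross3 (\<alpha>1 s) (\<alpha>2 s)) = \<kappa> s"
proof -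
  have "(norm (cross3 (\<alpha>1 s) (\<alpha>2 s)))\<^sup>2 = (\<kappa> s)\<^sup>2"
    unfolding norm_cross using assms
    by (simp add: inner_\<alpha>1_\<alpha>2 inner_\<alpha>1_\<alpha>1 inner_\<alpha>2_\<alpha>2 power2_norm_eq_inner)
  then show ?thesis using curvature_pos[OF assms] by (simp add: power2_eq_iff_nonneg)
qed

text \<open>The normal is \<open>\<alpha>2 / \<kappa>\<close>. In its derivative the term from \<open>1 / \<kappa>\<close> is
  parallel to \<open>\<alpha>2\<close>, hence orthogonal to the binormal, and only \<open>\<alpha>3 / \<kappa>\<close>
  contributes to the torsion.\<close>

lemma torsion_eq:
  assumes "s \<in> I"
  shows "cross3 (\<alpha>1 s) (\<alpha>2 s) \<bullet> \<alpha>3 s = (\<kappa> s)\<^sup>2 * \<tau> s"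
proof -
  have "(normal \<alpha> has_vector_derivative
      \<alpha>3 s /\<^sub>R \<kappa> s - (\<alpha>2 s \<bullet> \<alpha>3 s / \<kappa> s ^ 3) *\<^sub>R \<alpha>2 s) (at s)"
    unfolding normal_eq[abs_def] using curvature_pos[OF assms]
    by (auto intro!: derivative_eq_intros derivs curvature_deriv assms
       simp: field_simps power3_eq_cube)
  from vderiv_eqI[OF this] have "\<tau> s = (\<alpha>3 s \<bullet> cross3 (\<alpha>1 s) (\<alpha>2 s)) / (\<kappa> s)\<^sup>2"
    by (simp add: torsion_def binormal_eq inner_diff_left dot_cross_self power2_eq_square
        divide_inverse mult_ac)
  then show ?thesis using curvature_pos[OF assms] by (simp add: inner_commute)
qed

lemma deriv_rho:
  assumes "s \<in> I"
  shows "deriv (rho \<alpha>) s = - (\<alpha>2 s \<bullet> \<alpha>3 s) / \<kappa> s ^ 3"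
proof (rule DERIV_imp_deriv)
  show "(rho \<alpha> has_real_derivative - (\<alpha>2 s \<bullet> \<alpha>3 s) / \<kappa> s ^ 3) (at s)"
    unfolding rho_def[abs_def] using curvature_pos[OF assms]
    by (auto intro!: derivative_eq_intros curvature_deriv assms
       simp: field_simps power3_eq_cube)
qed

text \<open>This is the Frenet form of \<open>\<kappa>' = - \<kappa>\<^sup>2 \<rho>'\<close>, because
  \<open>\<alpha>2 \<bullet> \<alpha>3 = \<kappa> \<kappa>'\<close> and \<open>\<rho>' = \<tau> \<sigma>\<close>.\<close>

lemma inner_\<alpha>2_\<alpha>3:
  assumes "s \<in> I"
  shows "\<alpha>2 s \<bullet> \<alpha>3 s = - (\<kappa> s ^ 3 * \<tau> s * \<sigma> s)"
  using deriv_rho[OF assms] curvature_pos[OF assms] torsion_nonzero[OF assms]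
  by (simp add: rho'_over_tau_def field_simps)

section \<open>The position of the curve relative to its osculating sphere\<close>

abbreviation "radial s \<equiv> \<alpha> s - osc_center \<alpha> s"

lemma radial_eq:
  "radial s = - (\<alpha>2 s /\<^sub>R (\<kappa> s)\<^sup>2 + (\<sigma> s / \<kappa> s) *\<^sub>R cross3 (\<alpha>1 s) (\<alpha>2 s))"
  by (simp add: osc_center_def rho_def normal_eq binormal_eq power2_eq_square field_simps)

lemma inner_radial_\<alpha>1: "s \<in> I \<Longrightarrow> radial s \<bullet> \<alpha>1 s = 0"
  by (simp add: radial_eq inner_diff_right dot_cross_self inner_\<alpha>1_\<alpha>2 inner_commute[of _ "\<alpha>1 s"])

lemma inner_radial_\<alpha>2: "s \<in> I \<Longrightarrow> radial s \<bullet> \<alpha>2 s = - 1"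
  using curvature_pos[of s]
  by (simp add: radial_eq inner_left_distrib inner_diff_left dot_cross_self inner_\<alpha>2_\<alpha>2)

text \<open>This is the equation that fixes the binormal coordinate of the centre: the normal part of
  the radial vector contributes \<open>\<rho>'\<close> up to the factor \<open>\<kappa>\<close>, and the coefficient
  \<open>\<rho>' / \<tau>\<close> of the binormal is what cancels it.\<close>

lemma inner_radial_\<alpha>3: "s \<in> I \<Longrightarrow> radial s \<bullet> \<alpha>3 s = 0"
  using curvature_pos[of s]
  by (simp add: radial_eq inner_left_distrib inner_diff_left inner_\<alpha>2_\<alpha>3 torsion_eq field_simps eval_nat_numeral)

lemma J_eq:
  assumes "s \<in> I" shows "J \<alpha> s = - \<kappa> s * \<sigma> s"
  using curvature_pos[OF assms] norm_cross_\<alpha>1_\<alpha>2[OF assms]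
  by (simp add: J_def radial_eq inner_left_distrib inner_diff_left dot_cross_self dot_square_norm
      field_simps power2_eq_square)

lemma osc_radius_sq:
  assumes "s \<in> I"
  shows "(\<kappa> s)\<^sup>2 * (osc_radius \<alpha> s)\<^sup>2 = 1 + (J \<alpha> s)\<^sup>2"
  using curvature_pos[OF assms]
  by (simp add: osc_radius_def J_eq[OF assms] rho_def field_simps power2_eq_square)

lemma osc_radius_pos: "s \<in> I \<Longrightarrow> osc_radius \<alpha> s > 0"
  using curvature_pos[of s]
  by (simp add: osc_radius_def rho_def add_pos_nonneg)

lemma norm_radial:
  assumes "s \<in> I"
  shows "norm (radial s) = osc_radius \<alpha> s"
proof -
  have "cross3 (\<alpha>1 s) (\<alpha>2 s) \<bullet> cross3 (\<alpha>1 s) (\<alpha>2 s) = (\<kappa> s)\<^sup>2"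
    by (simp add: dot_square_norm norm_cross_\<alpha>1_\<alpha>2[OF assms])
  then have "radial s \<bullet> radial s = (rho \<alpha> s)\<^sup>2 + (\<sigma> s)\<^sup>2"
    using curvature_pos[OF assms]
    by (simp add: radial_eq inner_diff_left inner_diff_right inner_\<alpha>2_\<alpha>2
        dot_cross_self rho_def divide_simps power2_eq_square)
  then show ?thesis by (simp add: norm_eq_sqrt_inner osc_radius_def)
qed

text \<open>The normal part of the radial vector contributes \<open>\<tau>\<close>, by the triple product formula
  for the torsion. The binormal part contributes \<open>\<tau> \<kappa>\<^sup>2 \<sigma>\<^sup>2\<close>, which is
  \<open>\<tau> J\<^sup>2\<close>.\<close>

lemma inner_radial_cross_\<alpha>1_\<alpha>3:
  assumes "s \<in> I"
  shows "radial s \<bullet> cross3 (\<alpha>1 s) (\<alpha>3 s) = \<tau> s * (1 + (J \<alpha> s)\<^sup>2)"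
proof -
  have 1: "\<alpha>2 s \<bullet> cross3 (\<alpha>1 s) (\<alpha>3 s) = - ((\<kappa> s)\<^sup>2 * \<tau> s)"
    unfolding torsion_eq[OF assms, symmetric] by (simp add: cross3_simps)
  have 2: "cross3 (\<alpha>1 s) (\<alpha>2 s) \<bullet> cross3 (\<alpha>1 s) (\<alpha>3 s) = \<alpha>2 s \<bullet> \<alpha>3 s"
    by (simp add: dot_cross inner_\<alpha>1_\<alpha>1 inner_\<alpha>1_\<alpha>2 assms inner_commute)
  show ?thesis
    using curvature_pos[OF assms]
    by (simp add: radial_eq inner_left_distrib inner_diff_left 1 2 inner_\<alpha>2_\<alpha>3 assms J_eq
      field_simps eval_nat_numeral)
qed

text \<open>By unit speed, the inner products of the radial vector with \<open>\<alpha>1\<close>, \<open>\<alpha>2\<close> and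
  \<open>\<alpha>3\<close> give the contact equations for the projection from the centre of the osculating
  sphere.\<close>

lemma vderivs_osc_projection:
  assumes "s0 \<in> I"
  shows "vderiv (osc_projection \<alpha> s0) s0 = \<alpha>1 s0"
    and "vderiv (vderiv (osc_projection \<alpha> s0)) s0 = \<alpha>2 s0"
    and "vderiv (vderiv (vderiv (osc_projection \<alpha> s0))) s0 = \<alpha>3 s0"
proof -
  define f where "f = (\<lambda>t. \<alpha> t - osc_center \<alpha> s0)"
  have f: "(f has_vector_derivative \<alpha>1 t) (at t)" if "t \<in> I" for t
    unfolding f_def by (auto intro!: derivative_eq_intros derivs that)
  have nz: "f s0 \<noteq> 0"
    using norm_radial[OF assms] osc_radius_pos[OF assms] by (auto simp: f_def)
  have contact: "f s0 \<bullet> \<alpha>1 s0 = 0" "\<alpha>1 s0 \<bullet> \<alpha>1 s0 + f s0 \<bullet> \<alpha>2 s0 = 0"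
      "3 * (\<alpha>1 s0 \<bullet> \<alpha>2 s0) + f s0 \<bullet> \<alpha>3 s0 = 0"
    using assms inner_radial_\<alpha>1[of s0] inner_radial_\<alpha>2[of s0] inner_radial_\<alpha>3[of s0]
      inner_\<alpha>1_\<alpha>1[of s0] inner_\<alpha>1_\<alpha>2[of s0]
    by (simp_all add: f_def)
  have eq: "osc_projection \<alpha> s0 =
      (\<lambda>t. osc_center \<alpha> s0 + norm (f s0) *\<^sub>R (f t /\<^sub>R norm (f t)))"
    using norm_radial[OF assms] by (simp add: osc_projection_def f_def fun_eq_iff)
  note proj = vderivs_of_radial_projection[OF open_I assms f derivs(2,3) nz contact]
  show "vderiv (osc_projection \<alpha> s0) s0 = \<alpha>1 s0"
    "vderiv (vderiv (osc_projection \<alpha> s0)) s0 = \<alpha>2 s0"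
    "vderiv (vderiv (vderiv (osc_projection \<alpha> s0))) s0 = \<alpha>3 s0"
    unfolding eq by (rule proj; assumption)+
qed

text \<open>For a curve of class \<open>C\<^sup>3\<close> the quotient \<open>\<sigma> = \<rho>' / \<tau>\<close> need not be
  differentiable. Where it is, \<open>J' = - \<kappa>' \<sigma> - \<kappa> \<sigma>'\<close>, in which
  \<open>- \<kappa>' \<sigma> = \<tau> J\<^sup>2\<close>, while \<open>\<kappa> \<sigma>'\<close> is
  \<open>\<kappa> varsigma - \<tau>\<close> by the definition of \<open>varsigma\<close>.\<close>

lemma J_deriv:
  assumes "s \<in> I" "\<sigma> differentiable (at s)"
  shows "(J \<alpha> has_real_derivative \<tau> s * (1 + (J \<alpha> s)\<^sup>2) - \<kappa> s * varsigma \<alpha> s) (at s)"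
proof -
  have "(\<sigma> has_real_derivative deriv \<sigma> s) (at s)"
    using assms(2) by (simp add: DERIV_deriv_iff_real_differentiable)
  then have "((\<lambda>t. - \<kappa> t * \<sigma> t) has_real_derivative
      \<tau> s * (1 + (J \<alpha> s)\<^sup>2) - \<kappa> s * varsigma \<alpha> s) (at s)"
    using curvature_pos[OF assms(1)]
    by (auto intro!: derivative_eq_intros curvature_deriv assms
       simp: J_eq assms inner_\<alpha>2_\<alpha>3 varsigma_def rho_def field_simps eval_nat_numeral)
  then show ?thesis
    by (rule has_field_derivative_transform_within_open[OF _ open_I assms(1)]) (simp add: J_eq)
qed

end

section \<open>Curvature and torsion of the osculating projection\<close>

theorem theorem2p3p3:
  fixes \<alpha> :: "real \<Rightarrow> real^3" and I :: "real set" and s0 :: real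
  assumes "open I" and "is_interval I" and "s0 \<in> I"
    and "C_k_on 3 \<alpha> I"
    and "arc_length_on \<alpha> I"
    and "twisted_on \<alpha> I"
  shows "curvature \<alpha> s0 = reg_curvature (osc_projection \<alpha> s0) s0
    \<and> torsion \<alpha> s0 = reg_torsion (osc_projection \<alpha> s0) s0
    \<and> curvature \<alpha> s0 = 1 / osc_radius \<alpha> s0 * sqrt (1 + (J \<alpha> s0)\<^sup>2)
    \<and> torsion \<alpha> s0 =
        (\<alpha> s0 - osc_center \<alpha> s0) \<bullet> cross3 (vderiv \<alpha> s0) (vderiv (vderiv (vderiv \<alpha>)) s0)
        / (1 + (J \<alpha> s0)\<^sup>2)
    \<and> (rho'_over_tau \<alpha> differentiable (at s0) \<longrightarrow>
        J \<alpha> differentiable (at s0)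
        \<and> torsion \<alpha> s0 =
            deriv (J \<alpha>) s0 / (1 + (J \<alpha> s0)\<^sup>2)
            + curvature \<alpha> s0 * varsigma \<alpha> s0 / (1 + (J \<alpha> s0)\<^sup>2))"
proof -
  interpret twisted_unit_speed_curve \<alpha> I
    using assms by unfold_locales
  note s0 = \<open>s0 \<in> I\<close>
  have J_pos: "1 + (J \<alpha> s0)\<^sup>2 > 0" by (simp add: add_pos_nonneg)
  have "\<kappa> s0 = reg_curvature (osc_projection \<alpha> s0) s0"
    using inner_\<alpha>1_\<alpha>1[OF s0]
    by (simp add: reg_curvature_def vderivs_osc_projection[OF s0] norm_cross_\<alpha>1_\<alpha>2[OF s0]
        norm_eq_sqrt_inner[of "\<alpha>1 s0"])
  moreover have "\<tau> s0 = reg_torsion (osc_projection \<alpha> s0) s0"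
    using curvature_pos[OF s0]
    by (simp add: reg_torsion_def vderivs_osc_projection[OF s0] norm_cross_\<alpha>1_\<alpha>2[OF s0]
        torsion_eq[OF s0])
  moreover have "\<kappa> s0 = 1 / osc_radius \<alpha> s0 * sqrt (1 + (J \<alpha> s0)\<^sup>2)"
    using curvature_pos[OF s0] osc_radius_pos[OF s0]
    by (simp flip: osc_radius_sq[OF s0] add: real_sqrt_mult)
  moreover have "\<tau> s0 = radial s0 \<bullet> cross3 (\<alpha>1 s0) (\<alpha>3 s0) / (1 + (J \<alpha> s0)\<^sup>2)"
    using J_pos by (simp add: inner_radial_cross_\<alpha>1_\<alpha>3[OF s0])
  moreover have "J \<alpha> differentiable (at s0) \<and> \<tau> s0 =
      deriv (J \<alpha>) s0 / (1 + (J \<alpha> s0)\<^sup>2) + \<kappa> s0 * varsigma \<alpha> s0 / (1 + (J \<alpha> s0)\<^sup>2)"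
    if "\<sigma> differentiable (at s0)"
  proof
    note dJ = J_deriv[OF s0 that]
    show "J \<alpha> differentiable (at s0)"
      using dJ by (auto simp: real_differentiable_def)
    show "\<tau> s0 = deriv (J \<alpha>) s0 / (1 + (J \<alpha> s0)\<^sup>2) + \<kappa> s0 * varsigma \<alpha> s0 / (1 + (J \<alpha> s0)\<^sup>2)"
      unfolding DERIV_imp_deriv[OF dJ] using J_pos by (simp flip: add_divide_distrib)
  qed
  ultimately show ?thesis by blast
qed

end
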